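(* Let $a,b,c,d\in\mathbb{R}$ with $c\neq 0$ and $ad-bc=1$, and let $g(x)=\frac{ax+b}{cx+d}$ be the corresponding linear fractional map on $\hat{\mathbb{R}}=\mathbb{R}\cup\{\infty\}$. Suppose that $g$ is elliptic, that is, $-2<a+d<2$. Let $b_0\in\mathbb{R}$ and let $\{b_n\}_{n\in\mathbb{N}_0}$ be the solution of $b_{n+1}=g(b_n)$ for $n\in\mathbb{N}_0$. Then either $g^k(b_0)=\infty$ for some $k\in\mathbb{N}$, or $\{b_n\}_{n\in\mathbb{N}_0}$ is a sequence in $\mathbb{R}$ that has no Hyers-Ulam stability.
   Context: $\mathbb{N}=\{1,2,3,\dots\}$, $\mathbb{N}_0=\mathbb{N}\cup\{0\}$; $g^k$ is the $k$-fold composition of $g$. The map is defined at the special points by $g(-d/c)=\infty$ and $g(\infty)=a/c$. Hyers-Ulam stability (here in $\mathbb{R}$): the difference equation $b_{n+1}=g(b_n)$ ($n\in\mathbb{N}_0$) has Hyers-Ulam stability if there is a function $G:(0,\infty)\to(0,\infty)$ with $G(\varepsilon)\to 0$ as $\varepsilon\to 0$ such that for every $\varepsilon>0$ and every sequence $\{a_n\}_{n\in\mathbb{N}_0}$ in $\mathbb{R}$ with $g(a_n)\neq\infty$ and $|a_{n+1}-g(a_n)|\le\varepsilon$ for all $n\in\mathbb{N}_0$, there is a sequence $\{b_n\}_{n\in\mathbb{N}_0}$ in $\mathbb{R}$ satisfying $b_{n+1}=g(b_n)$ and $|a_n-b_n|\le G(\varepsilon)$ for all $n\in\mathbb{N}_0$.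 A sequence $\{b_n\}$ solving the difference equation is said to have no Hyers-Ulam stability if the difference equation it solves does not have Hyers-Ulam stability. *)

theory Defs
  imports Complex_Main
begin

text \<open>
  The extended real line \<open>\<real> \<union> {\<infinity>}\<close> is \<^typ>\<open>real option\<close>, with \<open>None\<close> as the point \<open>\<infinity>\<close>
  (the encoding also used for \<open>Alexandroff_compactification\<close> in HOL-Analysis).
  The maps are meant for \<open>c \<noteq> 0\<close>; then \<open>c * x + d = 0\<close> says exactly \<open>x = - d / c\<close>.
\<close>

definition linear_fractional ::
    "real \<Rightarrow> real \<Rightarrow> real \<Rightarrow> real \<Rightarrow> real option \<Rightarrow> real option" where
  "linear_fractional a b c d z =
     (case z of
        None \<Rightarrow> Some (a / c)
      | Some x \<Rightarrow> if c * x + d = 0 then None else Some ((a * x + b) / (c * x + d)))"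

text \<open>
  A real sequence solves \<open>b (n + 1) = g (b n)\<close>; in particular \<open>g (b n) \<noteq> \<infinity>\<close> for all \<open>n\<close>.
\<close>

definition solves_in_reals :: "(real option \<Rightarrow> real option) \<Rightarrow> (nat \<Rightarrow> real) \<Rightarrow> bool" where
  "solves_in_reals g b \<longleftrightarrow> (\<forall>n. g (Some (b n)) = Some (b (Suc n)))"

text \<open>
  A real sequence with \<open>g (u n) \<noteq> \<infinity>\<close> and \<open>\<bar>u (n + 1) - g (u n)\<bar> \<le> \<epsilon>\<close> for all \<open>n\<close>.
\<close>

definition approx_solves_in_reals ::
    "(real option \<Rightarrow> real option) \<Rightarrow> real \<Rightarrow> (nat \<Rightarrow> real) \<Rightarrow> bool" where
  "approx_solves_in_reals g \<epsilon> u \<longleftrightarrow>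
     (\<forall>n. \<exists>y. g (Some (u n)) = Some y \<and> \<bar>u (Suc n) - y\<bar> \<le> \<epsilon>)"

text \<open>
  The bound \<open>G\<close> is a function from \<open>(0, \<infinity>)\<close> to \<open>(0, \<infinity>)\<close>; its values at nonpositive arguments
  play no role, hence the one-sided limit.
\<close>

definition hyers_ulam_stable :: "(real option \<Rightarrow> real option) \<Rightarrow> bool" where
  "hyers_ulam_stable g \<longleftrightarrow>
     (\<exists>G :: real \<Rightarrow> real.
        (\<forall>\<epsilon>>0. G \<epsilon> > 0) \<and> (G \<longlongrightarrow> 0) (at_right 0) \<and>
        (\<forall>\<epsilon>>0. \<forall>u. approx_solves_in_reals g \<epsilon> u \<longrightarrow>
           (\<exists>b. solves_in_reals g b \<and> (\<forall>n. \<bar>u n - b n\<bar> \<le> G \<epsilon>))))"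

text \<open>
  By convention, a solution is said to have no Hyers-Ulam stability if the difference equation
  it solves is not Hyers-Ulam stable.
\<close>

definition no_hyers_ulam_stability :: "(real option \<Rightarrow> real option) \<Rightarrow> (nat \<Rightarrow> real) \<Rightarrow> bool" where
  "no_hyers_ulam_stability g b \<longleftrightarrow> solves_in_reals g b \<and> \<not> hyers_ulam_stable g"

end

theory Submission imports Defs "HOL-Analysis.Continuum_Not_Denumerable"
begin

text \<open>
  Writing \<open>p \<plusminus> i q\<close> for the fixed points of \<open>g\<close>, the substitution \<open>x = p + q tan \<phi>\<close> turns \<open>g\<close> into
  the rotation \<open>\<phi> \<mapsto> \<phi> + \<theta>\<close>, where \<open>2 cos \<theta> = a + d\<close>. Away from the poles of \<open>tan\<close>, an error
  \<open>\<epsilon>\<close> on the line permits an angular error proportional to \<open>\<epsilon>\<close>, and since \<open>sin \<theta> \<noteq> 0\<close> at least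
  one of any two consecutive iterates is uniformly away from the poles. So for every \<open>\<epsilon>\<close> there is an
  approximate solution whose phase, relative to the rotation, drifts from \<open>0\<close> to exactly \<open>\<pi> / 2\<close>.
  An exact solution has constant relative phase, so it cannot be close at both times: the sine and
  the cosine of the phase difference would both be small.
\<close>

section \<open>Tangent estimates\<close>

lemma abs_tan_diff:
  fixes x y :: real
  assumes "cos x \<noteq> 0" "cos y \<noteq> 0"
  shows "\<bar>tan x - tan y\<bar> = \<bar>sin (x - y)\<bar> / (\<bar>cos x\<bar> * \<bar>cos y\<bar>)"
proof -
  have "tan x - tan y = sin (x - y) / (cos x * cos y)"
    using assms by (simp add: tan_def sin_diff field_simps)
  then show ?thesis by (simp add: abs_mult)
qed

text \<open>The cosines in the denominator of \<open>abs_tan_diff\<close> have product at most 1 in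
  absolute value. This turns closeness on the line into closeness of phases modulo \<pi>.\<close>

lemma abs_sin_diff_le_abs_tan_diff:
  fixes x y :: real
  assumes "cos x \<noteq> 0" "cos y \<noteq> 0"
  shows "\<bar>sin (x - y)\<bar> \<le> \<bar>tan x - tan y\<bar>"
proof -
  have "\<bar>cos x\<bar> * \<bar>cos y\<bar> \<le> 1 * 1" by (intro mult_mono) auto
  then have "\<bar>sin (x - y)\<bar> * (\<bar>cos x\<bar> * \<bar>cos y\<bar>) \<le> \<bar>sin (x - y)\<bar>"
    by (simp add: mult_left_le)
  then show ?thesis
    unfolding abs_tan_diff[OF assms] using assms by (simp add: pos_le_divide_eq)
qed

text \<open>Cosine is 1-Lipschitz, so the shift keeps \<bar>cos\<bar> at least \<kappa>/2, and the
  denominator in \<open>abs_tan_diff\<close> is at least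
  \<open>\<kappa>\<^sup>2 / 2\<close>.\<close>

lemma tan_shift_bound:
  fixes x h \<kappa> :: real
  assumes "0 \<le> h" "h \<le> \<kappa> / 2" "\<kappa> > 0" "\<kappa> \<le> \<bar>cos x\<bar>"
  shows "\<bar>tan (x + h) - tan x\<bar> \<le> 2 * h / \<kappa>\<^sup>2"
proof -
  have "\<bar>cos (x + h) - cos x\<bar> = 2 * \<bar>sin (x + h / 2)\<bar> * \<bar>sin (h / 2)\<bar>"
    by (simp add: cos_diff_cos abs_mult add_divide_distrib)
  also have "\<dots> \<le> 2 * 1 * \<bar>h / 2\<bar>"
    by (intro mult_mono abs_sin_x_le_abs_x) auto
  finally have "\<bar>cos (x + h) - cos x\<bar> \<le> h" using assms by simp
  then have lower: "\<kappa> / 2 \<le> \<bar>cos (x + h)\<bar>" using assms by linarith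
  have "cos x \<noteq> 0" "cos (x + h) \<noteq> 0" using lower assms by auto
  then have "\<bar>tan (x + h) - tan x\<bar> = \<bar>sin h\<bar> / (\<bar>cos (x + h)\<bar> * \<bar>cos x\<bar>)"
    by (subst abs_tan_diff) auto
  also have "\<dots> \<le> h / (\<kappa> / 2 * \<kappa>)"
    using assms lower abs_sin_x_le_abs_x[of h] by (intro frac_le mult_mono) auto
  finally show ?thesis by (simp add: power2_eq_square mult.commute)
qed

section \<open>Conjugation to a rotation\<close>

lemma linear_fractional_tan:
  fixes a b c d \<theta> \<phi> :: real
  defines "p \<equiv> (a - d) / (2 * c)" and "q \<equiv> - sin \<theta> / c"
  assumes c: "c \<noteq> 0" and det: "a * d - b * c = 1" and \<theta>: "2 * cos \<theta> = a + d"
    and \<phi>: "cos \<phi> \<noteq> 0"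
  shows "linear_fractional a b c d (Some (p + q * tan \<phi>)) =
    (if cos (\<phi> + \<theta>) = 0 then None else Some (p + q * tan (\<phi> + \<theta>)))"
proof -
  \<comment> \<open>With z = p + i q, the facts \<open>cp\<close>, \<open>cq\<close>,
    \<open>ap\<close>, \<open>aq\<close> are the real and imaginary parts of c z + d = exp(-i
    \<theta>) and a z + b = exp(-i \<theta>) z: the vector (z, 1) is an eigenvector of the
    matrix.\<close>
  have cp: "c * p + d = cos \<theta>" and cq: "c * q = - sin \<theta>"
    using c \<theta> by (auto simp: p_def q_def field_simps)
  have apd: "a - cos \<theta> = c * p" using cp c \<theta> by (simp add: p_def field_simps)
  have aq: "a * q = q * cos \<theta> - p * sin \<theta>"
  proof -
    have "a * q - q * cos \<theta> = p * (c * q)"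
      using apd by (metis left_diff_distrib mult.commute mult.left_commute)
    then show ?thesis using cq by simp
  qed
  have ap: "a * p + b = p * cos \<theta> + q * sin \<theta>"
  proof -
    \<comment> \<open>The factor \<open>c\<close> makes the determinant usable through
      \<open>b * c = a * d - 1\<close>; what remains vanishes by the trace condition.\<close>
    have "c * (a * p + b - p * cos \<theta> - q * sin \<theta>) = (c * p) * (a - cos \<theta>) + b * c - (c * q) * sin \<theta>"
      by (simp add: algebra_simps)
    also have "\<dots> = (a - cos \<theta>)\<^sup>2 + (a * d - 1) + (sin \<theta>)\<^sup>2"
      using det unfolding apd[symmetric] cq by (simp add: power2_eq_square)
    also have "\<dots> = a * (a + d - 2 * cos \<theta>)"
      unfolding sin_squared_eq by (simp add: power2_eq_square algebra_simps)
    finally show ?thesis using c \<theta> by simp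
  qed
  have den: "c * (p + q * tan \<phi>) + d = cos (\<phi> + \<theta>) / cos \<phi>"
  proof -
    have "c * (p + q * tan \<phi>) + d = (c * p + d) + (c * q) * tan \<phi>"
      by (simp add: algebra_simps)
    then show ?thesis
      unfolding cp cq using \<phi> by (simp add: tan_def cos_add field_simps)
  qed
  have num: "a * (p + q * tan \<phi>) + b = (p * cos (\<phi> + \<theta>) + q * sin (\<phi> + \<theta>)) / cos \<phi>"
  proof -
    have "a * (p + q * tan \<phi>) + b = (a * p + b) + (a * q) * tan \<phi>"
      by (simp add: algebra_simps)
    then show ?thesis
      unfolding ap aq using \<phi> by (simp add: tan_def cos_add sin_add field_simps)
  qed
  show ?thesis
    unfolding linear_fractional_def option.case den num
    using \<phi> by (simp add: tan_def field_simps)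
qed

text \<open>Since \<open>q\<close> is nonzero, arctan supplies the initial phase. A real solution
  never reaches \<infinity>, so the \<open>None\<close> branch of
  \<open>linear_fractional_tan\<close> is excluded at each step and the phase just rotates.\<close>

lemma solution_tan_form:
  fixes a b c d \<theta> :: real
  defines "p \<equiv> (a - d) / (2 * c)" and "q \<equiv> - sin \<theta> / c"
  assumes c: "c \<noteq> 0" and det: "a * d - b * c = 1" and \<theta>: "2 * cos \<theta> = a + d"
    and "sin \<theta> \<noteq> 0"
    and sol: "solves_in_reals (linear_fractional a b c d) s"
  obtains \<beta> where "\<And>n. cos (\<beta> + real n * \<theta>) \<noteq> 0"
    and "\<And>n. s n = p + q * tan (\<beta> + real n * \<theta>)"
proof -
  define \<beta> where "\<beta> = arctan ((s 0 - p) / q)"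
  have "q \<noteq> 0" using assms by simp
  have *: "cos (\<beta> + real n * \<theta>) \<noteq> 0 \<and> s n = p + q * tan (\<beta> + real n * \<theta>)" for n
  proof (induction n)
    case 0
    then show ?case using \<open>q \<noteq> 0\<close> by (simp add: \<beta>_def tan_arctan)
  next
    case (Suc n)
    have shift: "\<beta> + real n * \<theta> + \<theta> = \<beta> + real (Suc n) * \<theta>" by (simp add: algebra_simps)
    have "linear_fractional a b c d (Some (s n)) = Some (s (Suc n))"
      using sol by (simp add: solves_in_reals_def)
    then show ?case
      using linear_fractional_tan[OF c det \<theta>, of "\<beta> + real n * \<theta>"] Suc
      unfolding shift p_def q_def by (auto split: if_splits)
  qed
  show thesis by (rule that[of \<beta>]) (use * in auto)
qed

section \<open>Construction of the drifting approximate solution\<close>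

text \<open>Each condition excludes countably many phases and there are countably many conditions,
  while the reals are uncountable.\<close>

lemma ex_phase_avoiding_poles:
  fixes \<theta> \<eta> :: real
  obtains \<psi> where "\<And>n j. cos (\<psi> + real n * \<theta> + real j * \<eta>) \<noteq> 0"
proof -
  define B where "B = (\<lambda>(n::nat, j::nat, i::int). of_int i * (pi / 2) - real n * \<theta> - real j * \<eta>) ` UNIV"
  have "countable B" unfolding B_def by simp
  then have "B \<noteq> UNIV" using uncountable_UNIV_real by auto
  then obtain \<psi> where \<psi>: "\<psi> \<notin> B" by auto
  have "cos (\<psi> + real n * \<theta> + real j * \<eta>) \<noteq> 0" for n j
  proof
    assume "cos (\<psi> + real n * \<theta> + real j * \<eta>) = 0"
    then obtain i where "\<psi> + real n * \<theta> + real j * \<eta> = of_int i * (pi / 2)"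
      unfolding cos_zero_iff_int by blast
    then have "\<psi> = (\<lambda>(n, j, i). of_int i * (pi / 2) - real n * \<theta> - real j * \<eta>) (n, j, i)"
      by simp
    with \<psi> show False unfolding B_def by blast
  qed
  with that show thesis by blast
qed

lemma drifting_approx_solution:
  fixes a b c d \<theta> \<epsilon> :: real
  defines "p \<equiv> (a - d) / (2 * c)" and "q \<equiv> - sin \<theta> / c"
  assumes c: "c \<noteq> 0" and det: "a * d - b * c = 1" and \<theta>: "2 * cos \<theta> = a + d"
    and sin: "sin \<theta> \<noteq> 0" and \<epsilon>: "\<epsilon> > 0"
  obtains u \<psi> N where "approx_solves_in_reals (linear_fractional a b c d) \<epsilon> u"
    and "cos \<psi> \<noteq> 0" "u 0 = p + q * tan \<psi>"
    and "cos (\<psi> + real N * \<theta> + pi / 2) \<noteq> 0" "u N = p + q * tan (\<psi> + real N * \<theta> + pi / 2)"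
proof -
  \<comment> \<open>With this threshold, \<open>\<bar>cos x\<bar>\<close> and
    \<open>\<bar>cos (x + \<theta>)\<bar>\<close> are never both below \<kappa>; see
    \<open>one_good\<close>.\<close>
  define \<kappa> where "\<kappa> = \<bar>sin \<theta>\<bar> / 2"
  have \<kappa>: "\<kappa> > 0" using sin by (simp add: \<kappa>_def)
  have q: "\<bar>q\<bar> > 0" using sin c by (simp add: q_def)
  \<comment> \<open>The first bound is the hypothesis of \<open>tan_shift_bound\<close>; the second
    makes the resulting error on the line at most \<epsilon>.\<close>
  define m where "m = min (\<kappa> / 2) (\<epsilon> * \<kappa>\<^sup>2 / (2 * \<bar>q\<bar>))"
  have m: "m > 0" using \<kappa> q \<epsilon> by (simp add: m_def)
  obtain K0 :: nat where K0: "pi / 2 / m < real K0" using reals_Archimedean2 by blast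
  \<comment> \<open>\<open>K\<close> is positive, so \<open>K\<close> drift steps of size \<eta> add
    up to exactly \<pi>/2.\<close>
  define K where "K = Suc K0"
  define \<eta> where "\<eta> = pi / 2 / real K"
  have K\<eta>: "real K * \<eta> = pi / 2" by (simp add: \<eta>_def K_def del: of_nat_Suc)
  have \<eta>0: "\<eta> \<ge> 0" by (simp add: \<eta>_def)
  have "pi / 2 / m < real K" using K0 by (simp add: K_def)
  then have "\<eta> \<le> m"
    using m by (simp add: \<eta>_def field_simps K_def)
  then have \<eta>1: "\<eta> \<le> \<kappa> / 2" and \<eta>2: "\<eta> \<le> \<epsilon> * \<kappa>\<^sup>2 / (2 * \<bar>q\<bar>)" by (auto simp: m_def)
  have err: "\<bar>q\<bar> * (2 * \<eta> / \<kappa>\<^sup>2) \<le> \<epsilon>"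
    using \<eta>2 \<kappa> q by (simp add: field_simps)
  obtain \<psi> where \<psi>: "\<And>n j. cos (\<psi> + real n * \<theta> + real j * \<eta>) \<noteq> 0"
    using ex_phase_avoiding_poles by metis
  \<comment> \<open>\<open>J n\<close> counts the drift steps taken up to time \<open>n\<close>. A
    step is taken greedily, whenever the rotated phase is far enough from the poles.\<close>
  define J where "J = rec_nat (0::nat) (\<lambda>n j.
    if \<kappa> \<le> \<bar>cos (\<psi> + real (Suc n) * \<theta> + real j * \<eta>)\<bar> then Suc j else j)"
  have J0: "J 0 = 0"
    and J_Suc: "\<And>n. J (Suc n) =
      (if \<kappa> \<le> \<bar>cos (\<psi> + real (Suc n) * \<theta> + real (J n) * \<eta>)\<bar> then Suc (J n) else J n)"
    by (simp_all add: J_def)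
  define \<phi> where "\<phi> n = \<psi> + real n * \<theta> + real (J n) * \<eta>" for n
  define u where "u n = p + q * tan (\<phi> n)" for n
  have cos\<phi>: "cos (\<phi> n) \<noteq> 0" for n unfolding \<phi>_def by (rule \<psi>)
  have approx: "approx_solves_in_reals (linear_fractional a b c d) \<epsilon> u"
    unfolding approx_solves_in_reals_def
  proof
    fix n
    \<comment> \<open>The phase after applying the exact map and before any drift; this is the phase
      tested in \<open>J_Suc\<close>.\<close>
    define x where "x = \<psi> + real (Suc n) * \<theta> + real (J n) * \<eta>"
    have \<phi>x: "\<phi> n + \<theta> = x" by (simp add: \<phi>_def x_def algebra_simps)
    have "cos x \<noteq> 0" unfolding x_def by (rule \<psi>)
    then have 1: "linear_fractional a b c d (Some (u n)) = Some (p + q * tan x)"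
      using linear_fractional_tan[OF c det \<theta> cos\<phi>[of n]]
      by (simp add: u_def p_def q_def \<phi>x)
    have 2: "\<bar>u (Suc n) - (p + q * tan x)\<bar> \<le> \<epsilon>"
    proof (cases "\<kappa> \<le> \<bar>cos x\<bar>")
      case True
      then have "\<phi> (Suc n) = x + \<eta>"
        by (simp add: \<phi>_def J_Suc x_def algebra_simps)
      then have "\<bar>u (Suc n) - (p + q * tan x)\<bar> = \<bar>q\<bar> * \<bar>tan (x + \<eta>) - tan x\<bar>"
        by (simp add: u_def flip: abs_mult right_diff_distrib)
      also have "\<dots> \<le> \<bar>q\<bar> * (2 * \<eta> / \<kappa>\<^sup>2)"
        using tan_shift_bound[OF \<eta>0 \<eta>1 \<kappa> True] by (intro mult_left_mono) auto
      finally show ?thesis using err by linarith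
    next
      case False
      then have "\<phi> (Suc n) = x" unfolding \<phi>_def J_Suc x_def by simp
      then show ?thesis using \<epsilon> by (simp add: u_def)
    qed
    from 1 2 show "\<exists>y. linear_fractional a b c d (Some (u n)) = Some y \<and> \<bar>u (Suc n) - y\<bar> \<le> \<epsilon>"
      by blast
  qed
  \<comment> \<open>Expanding sin \<theta> = sin ((x + \<theta>) - x) bounds
    \<open>\<bar>sin \<theta>\<bar> = 2 * \<kappa>\<close> by the sum of the two cosines in absolute
    value.\<close>
  have one_good: "\<kappa> \<le> \<bar>cos (x + \<theta>)\<bar>" if "\<not> \<kappa> \<le> \<bar>cos x\<bar>" for x
  proof -
    have "sin \<theta> = sin (x + \<theta>) * cos x - cos (x + \<theta>) * sin x"
      using sin_diff[of "x + \<theta>" x] by simp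
    then have "\<bar>sin \<theta>\<bar> \<le> \<bar>sin (x + \<theta>)\<bar> * \<bar>cos x\<bar> + \<bar>cos (x + \<theta>)\<bar> * \<bar>sin x\<bar>"
      by (metis abs_mult abs_triangle_ineq4)
    also have "\<dots> \<le> 1 * \<bar>cos x\<bar> + \<bar>cos (x + \<theta>)\<bar> * 1"
      by (intro add_mono mult_mono) auto
    finally show ?thesis using that unfolding \<kappa>_def by linarith
  qed
  \<comment> \<open>The counter grows by at most one at a time, and by \<open>one_good\<close> it
    grows within any two consecutive steps, so no value is skipped.\<close>
  have reach: "\<exists>n. J n = k" for k
  proof (induction k)
    case 0
    show ?case using J0 by blast
  next
    case (Suc k)
    then obtain n where n: "J n = k" by blast
    show ?case
    proof (cases "\<kappa> \<le> \<bar>cos (\<psi> + real (Suc n) * \<theta> + real k * \<eta>)\<bar>")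
      case True
      then have "J (Suc n) = Suc k" unfolding J_Suc n by simp
      then show ?thesis by blast
    next
      case False
      then have Jn: "J (Suc n) = k" unfolding J_Suc n by simp
      have next_angle: "\<psi> + real (Suc n) * \<theta> + real k * \<eta> + \<theta> = \<psi> + real (Suc (Suc n)) * \<theta> + real k * \<eta>"
        by (simp add: algebra_simps)
      have "J (Suc (Suc n)) = Suc k"
        using one_good[OF False] unfolding J_Suc[of "Suc n"] Jn next_angle by (simp only: if_True)
      then show ?thesis by blast
    qed
  qed
  obtain N where N: "J N = K" using reach by blast
  show thesis
  proof (rule that[of u \<psi> N])
    show "cos \<psi> \<noteq> 0" "u 0 = p + q * tan \<psi>"
      using cos\<phi>[of 0] by (simp_all add: \<phi>_def J0 u_def)
    show "cos (\<psi> + real N * \<theta> + pi / 2) \<noteq> 0" "u N = p + q * tan (\<psi> + real N * \<theta> + pi / 2)"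
      using cos\<phi>[of N] by (simp_all only: \<phi>_def N K\<eta> u_def not_False_eq_True)
  qed (fact approx)
qed

section \<open>Failure of stability\<close>

lemma elliptic_not_hyers_ulam_stable:
  fixes a b c d :: real
  assumes c: "c \<noteq> 0" and det: "a * d - b * c = 1" and "- 2 < a + d" "a + d < 2"
  shows "\<not> hyers_ulam_stable (linear_fractional a b c d)"
proof
  assume "hyers_ulam_stable (linear_fractional a b c d)"
  then obtain G where lim: "(G \<longlongrightarrow> 0) (at_right (0::real))"
    and shadow: "\<And>\<epsilon> u. \<epsilon> > 0 \<Longrightarrow> approx_solves_in_reals (linear_fractional a b c d) \<epsilon> u \<Longrightarrow>
      \<exists>s. solves_in_reals (linear_fractional a b c d) s \<and> (\<forall>n. \<bar>u n - s n\<bar> \<le> G \<epsilon>)"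
    unfolding hyers_ulam_stable_def by blast
  define \<theta> where "\<theta> = arccos ((a + d) / 2)"
  define p where "p = (a - d) / (2 * c)"
  define q where "q = - sin \<theta> / c"
  have \<theta>: "2 * cos \<theta> = a + d" using assms by (simp add: \<theta>_def)
  \<comment> \<open>Ellipticity enters here: the strict trace bounds keep \<theta> inside (0,
    \<pi>), whence \<open>sin \<theta>\<close> and \<open>q\<close> are nonzero.\<close>
  have "0 < \<theta>" "\<theta> < pi"
    using arccos_lt_bounded[of "(a + d) / 2"] assms by (auto simp: \<theta>_def)
  then have sin: "sin \<theta> \<noteq> 0" using sin_gt_zero by force
  have q: "\<bar>q\<bar> > 0" using sin c by (simp add: q_def)
  \<comment> \<open>Dividing by \<open>\<bar>q\<bar>\<close> bounds sine and cosine of one angle by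
    1/2, and two squares below 1/4 cannot sum to 1.\<close>
  have "\<forall>\<^sub>F \<epsilon> in at_right 0. G \<epsilon> < \<bar>q\<bar> / 2"
    using lim q by (intro order_tendstoD(2)[of G 0]) auto
  then have "\<forall>\<^sub>F \<epsilon> in at_right 0. G \<epsilon> < \<bar>q\<bar> / 2 \<and> \<epsilon> > 0"
    using eventually_at_right_less[of 0] by (rule eventually_conj)
  then obtain \<epsilon> where G: "G \<epsilon> < \<bar>q\<bar> / 2" and \<epsilon>: "\<epsilon> > 0"
    using eventually_happens'[of "at_right (0::real)"] trivial_limit_at_right_real by blast
  obtain u \<psi> N where u: "approx_solves_in_reals (linear_fractional a b c d) \<epsilon> u"
    and u0: "cos \<psi> \<noteq> 0" "u 0 = p + q * tan \<psi>"
    and uN: "cos (\<psi> + real N * \<theta> + pi / 2) \<noteq> 0" "u N = p + q * tan (\<psi> + real N * \<theta> + pi / 2)"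
    using drifting_approx_solution[OF c det \<theta> sin \<epsilon>] unfolding p_def q_def by metis
  obtain s where s: "solves_in_reals (linear_fractional a b c d) s"
    and near: "\<And>n. \<bar>u n - s n\<bar> \<le> G \<epsilon>"
    using shadow[OF \<epsilon> u] by blast
  obtain \<beta> where \<beta>: "\<And>n. cos (\<beta> + real n * \<theta>) \<noteq> 0" "\<And>n. s n = p + q * tan (\<beta> + real n * \<theta>)"
    using solution_tan_form[OF c det \<theta> sin s] unfolding p_def q_def by metis
  have close: "\<bar>sin (x - y)\<bar> < 1 / 2"
    if "cos x \<noteq> 0" "cos y \<noteq> 0" "\<bar>(p + q * tan x) - (p + q * tan y)\<bar> \<le> G \<epsilon>" for x y
  proof -
    have "\<bar>q\<bar> * \<bar>sin (x - y)\<bar> \<le> \<bar>q\<bar> * \<bar>tan x - tan y\<bar>"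
      using abs_sin_diff_le_abs_tan_diff[OF that(1,2)] by (intro mult_left_mono) auto
    also have "\<dots> = \<bar>(p + q * tan x) - (p + q * tan y)\<bar>"
      by (simp flip: abs_mult right_diff_distrib)
    also have "\<dots> < \<bar>q\<bar> * (1 / 2)" using that(3) G by simp
    finally show ?thesis using q by (simp only: mult_less_cancel_left_pos)
  qed
  have 1: "\<bar>sin (\<psi> - \<beta>)\<bar> < 1 / 2"
    using close[of \<psi> \<beta>] u0 \<beta>(1)[of 0] \<beta>(2)[of 0] near[of 0] by simp
  have "\<bar>sin (\<psi> + real N * \<theta> + pi / 2 - (\<beta> + real N * \<theta>))\<bar> < 1 / 2"
    by (rule close[OF uN(1) \<beta>(1)]) (use uN(2) \<beta>(2)[of N] near[of N] in simp)
  \<comment> \<open>The rotation cancels, and the accumulated quarter turn changes the sine into a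
    cosine.\<close>
  also have "\<psi> + real N * \<theta> + pi / 2 - (\<beta> + real N * \<theta>) = (\<psi> - \<beta>) + pi / 2" by simp
  finally have 2: "\<bar>cos (\<psi> - \<beta>)\<bar> < 1 / 2" by (simp add: sin_add)
  have "(sin (\<psi> - \<beta>))\<^sup>2 < (1 / 2)\<^sup>2" "(cos (\<psi> - \<beta>))\<^sup>2 < (1 / 2)\<^sup>2"
    using 1 2 by (simp_all add: abs_square_less_1 power2_strict_mono)
  then show False
    using sin_cos_squared_add[of "\<psi> - \<beta>"] by (simp add: power2_eq_square)
qed

theorem theorem5p3:
  fixes a b c d b0 :: real
    and g :: "real option \<Rightarrow> real option"
    and bs :: "nat \<Rightarrow> real option"
  assumes "c \<noteq> 0"
    and "a * d - b * c = 1"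
    and "g = linear_fractional a b c d"
    and "- 2 < a + d" and "a + d < 2"
    and "bs 0 = Some b0"
    and "\<And>n. bs (Suc n) = g (bs n)"
  shows "(\<exists>k\<ge>1. (g ^^ k) (Some b0) = None) \<or>
         (\<exists>\<beta> :: nat \<Rightarrow> real. (\<forall>n. bs n = Some (\<beta> n)) \<and> no_hyers_ulam_stability g \<beta>)"
proof (cases "\<exists>k\<ge>1. (g ^^ k) (Some b0) = None")
  case False
  have bs: "bs n = (g ^^ n) (Some b0)" for n
    by (induction n) (use assms in auto)
  \<comment> \<open>The negated alternative covers only k \<ge> 1; at index 0 the value is the real
    number \<open>b0\<close>.\<close>
  have "bs n \<noteq> None" for n
  proof (cases n)
    case 0
    then show ?thesis using assms(6) by simp
  next
    case (Suc m)
    then show ?thesis using False unfolding bs by (metis le_add1 plus_1_eq_Suc)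
  qed
  then have \<beta>: "bs n = Some (the (bs n))" for n by simp
  have "solves_in_reals g (\<lambda>n. the (bs n))"
    unfolding solves_in_reals_def using assms(7) \<beta> by metis
  then have "no_hyers_ulam_stability g (\<lambda>n. the (bs n))"
    unfolding no_hyers_ulam_stability_def
    using elliptic_not_hyers_ulam_stable assms(1-5) by blast
  then show ?thesis by (intro disjI2 exI[of _ "\<lambda>n. the (bs n)"] conjI allI \<beta>)
qed blast

end
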